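(* Let $\overline{\mathcal{T}}=\{(a,b)\in\mathbb{R}^2: 0\le a\le b\le 1\}$ and let $H:\overline{\mathcal{T}}\to\mathbb{R}$ be an analytic function given by a power series $$H(a,b)=\sum_{i,j\ge 0}c_{ij}a^ib^j$$ with real coefficients $c_{ij}$, converging absolutely at every point of $\overline{\mathcal{T}}$. The following are equivalent: 1. There exists some $f:[0,1]\to\mathbb{R}$ such that $\mathrm{DQ}_f(a,b)=H(a,b)$ on $\overline{\mathcal{T}}$. 2. For each $p\in\mathbb{N}$, there exists a constant $c_p$ such that for all integers $i,j\ge 0$ with $i+j=p$, $c_{ij}=c_p$.
   Context: For a function $f:[0,1]\to\mathbb{R}$, the difference quotient is $\mathrm{DQ}_f(a,b)=\dfrac{f(b)-f(a)}{b-a}$ for $0\le a<b\le 1$. It is extended to the diagonal by $\mathrm{DQ}_f(a,a)=f'(a)$ for $0\le a\le 1$, provided that the derivative exists (one-sided at the endpoints $0$ and $1$). Thus $\mathrm{DQ}_f=H$ on $\overline{\mathcal{T}}$ means that $f$ is differentiable on $[0,1]$, $f'(a)=H(a,a)$ for every $a\in[0,1]$, and $\frac{f(b)-f(a)}{b-a}=H(a,b)$ for all $0\le a<b\le1$. All variables and functions are real-valued. *)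

theory Defs
  imports "HOL-Analysis.Analysis"
begin

definition T_bar :: "(real \<times> real) set" where
  "T_bar = {(a, b). 0 \<le> a \<and> a \<le> b \<and> b \<le> 1}"

(* On the diagonal this is f'(a), one-sided at the endpoints 0 and 1; it is meaningful only
   where f is differentiable within [0,1]. *)
definition DQ :: "(real \<Rightarrow> real) \<Rightarrow> real \<times> real \<Rightarrow> real" where
  "DQ f = (\<lambda>(a, b). if a = b then vector_derivative f (at a within {0..1})
                     else (f b - f a) / (b - a))"

(* A function on [0,1] is a total function whose values outside [0,1] are never used.
   Since vector_derivative is total, existence of the derivatives is a separate conjunct. *)
definition DQ_equals :: "(real \<Rightarrow> real) \<Rightarrow> (real \<times> real \<Rightarrow> real) \<Rightarrow> bool" where
  "DQ_equals f H \<longleftrightarrow> f differentiable_on {0..1} \<and> (\<forall>x\<in>T_bar. DQ f x = H x)"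

end

theory Submission
  imports Defs "HOL-Complex_Analysis.Cauchy_Integral_Formula"
begin

text \<open>
  Absolute convergence allows the double series to be summed along diagonals, so that
  \<open>H\<close> becomes a series of homogeneous polynomials
  \<open>h\<^sub>p(a, b) = (\<Sum>i\<le>p. c i (p - i) * a ^ i * b ^ (p - i))\<close>.

  If \<open>c i j = d (i + j)\<close>, then \<open>h\<^sub>p(a, b) = d p * (b ^ (p + 1) - a ^ (p + 1)) / (b - a)\<close>, which is
  the difference quotient of \<open>d p * x ^ (p + 1)\<close>; hence \<open>f x = (\<Sum>p. d p * x ^ (p + 1))\<close> has the
  difference quotient \<open>H\<close> off the diagonal. Absolute convergence at the corner \<open>(1, 1)\<close> says that
  \<open>\<Sum>p. (p + 1) * \<bar>d p\<bar>\<close> is finite, so by the Weierstrass test the series of the \<open>h\<^sub>p\<close> is continuous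
  up to the boundary of the square, and the difference quotients of \<open>f\<close> converge to the value of
  \<open>H\<close> on the diagonal, also at the endpoint 1 (lemma \<open>primitive_DQ_equals\<close>).

  Conversely, a difference quotient satisfies \<open>(b - a) H(a, b) = b H(0, b) - a H(0, a)\<close>, as both
  sides equal \<open>f b - f a\<close>. Along the ray \<open>a = s b\<close>, with \<open>0 < s < 1\<close> fixed, this is an identity
  between power series in \<open>b\<close>. Comparing the coefficients gives, for every \<open>p\<close>,
  \<open>(1 - s) (\<Sum>i\<le>p. c i (p - i) * s ^ i) = c 0 p * (1 - s ^ (p + 1))\<close>.
  After division by \<open>1 - s\<close> this is an identity between polynomials in \<open>s\<close> with infinitely many
  solutions, so \<open>c i (p - i) = c 0 p\<close> (lemma \<open>DQ_coeffs_const_on_diagonals\<close>).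
  Only one-variable uniqueness theorems are used.
\<close>

section \<open>Summation along diagonals\<close>

lemma has_sum_imp_diagonals_sums:
  fixes F :: "nat \<times> nat \<Rightarrow> real"
  assumes "(F has_sum S) UNIV"
  shows "(\<lambda>p. \<Sum>i\<le>p. F (i, p - i)) sums S"
proof -
  have bij: "bij_betw (\<lambda>(p, i). (i, p - i)) (SIGMA p:UNIV. {..p}) (UNIV :: (nat \<times> nat) set)"
    by (rule bij_betwI[where g = "\<lambda>(i, j). (i + j, i)"]) auto
  have "((\<lambda>x. F ((\<lambda>(p, i). (i, p - i)) x)) has_sum S) (SIGMA p:UNIV. {..p})"
    using has_sum_reindex_bij_betw[OF bij, of F S] assms by simp
  then have "((\<lambda>p. \<Sum>i\<le>p. F (i, p - i)) has_sum S) UNIV"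
    by (rule has_sum_SigmaD) (auto intro!: has_sum_finiteI)
  then show ?thesis
    by (rule has_sum_imp_sums)
qed

section \<open>The coefficients of a difference quotient\<close>

text \<open>
  The interval is one-sided because the rays that are used below only exist for nonnegative
  parameters.
\<close>

lemma powser_zero_coeffs:
  fixes g :: "nat \<Rightarrow> real"
  assumes zero: "\<And>x. 0 < x \<Longrightarrow> x < 1 \<Longrightarrow> (\<lambda>n. g n * x ^ n) sums 0"
  shows "g m = 0"
proof (rule ccontr)
  assume "g m \<noteq> 0"
  \<comment> \<open>Multiplication by \<open>x\<close> makes the sum vanish at 0, and so 0 is an isolated zero of it.\<close>
  define a where "a n = (case n of 0 \<Rightarrow> 0 | Suc k \<Rightarrow> g k)" for n
  have summable: "summable (\<lambda>n. g n * x ^ n)" if "\<bar>x\<bar> < 1" for x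
  proof -
    obtain y where "\<bar>x\<bar> < y" "y < 1"
      using dense[of "\<bar>x\<bar>" 1] \<open>\<bar>x\<bar> < 1\<close> by blast
    then have "0 < y"
      by linarith
    from powser_inside[OF sums_summable[OF zero[OF this \<open>y < 1\<close>]]] show ?thesis
      using \<open>\<bar>x\<bar> < y\<close> \<open>0 < y\<close> by simp
  qed
  have shift: "(\<lambda>n. a n * x ^ n) sums (x * t)" if "(\<lambda>n. g n * x ^ n) sums t" for x t
  proof -
    have "(\<lambda>n. a (Suc n) * x ^ Suc n) sums (x * t)"
      using sums_mult[OF that, of x] by (simp add: a_def mult_ac)
    then show ?thesis
      by (subst (asm) sums_Suc_iff) (simp add: a_def)
  qed
  have series: "(\<lambda>n. a n * (x - 0) ^ n) sums (x * (\<Sum>n. g n * x ^ n))" if "norm (x - 0) < 1" for x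
    using shift[OF summable_sums[OF summable[of x]]] that by simp
  have "a (Suc m) \<noteq> 0"
    using \<open>g m \<noteq> 0\<close> by (simp add: a_def)
  then obtain s where s: "0 < s"
    and nz: "\<And>z. z \<in> cball 0 s - {0} \<Longrightarrow> z * (\<Sum>n. g n * z ^ n) \<noteq> 0"
    using powser_0_nonzero[OF zero_less_one series mult_zero_left _ zero_less_Suc] by blast
  define z where "z = min s (1/2)"
  have "0 < z" "z < 1" "z \<in> cball 0 s - {0}"
    using s by (auto simp: z_def)
  moreover have "(\<Sum>n. g n * z ^ n) = 0"
    using zero[OF \<open>0 < z\<close> \<open>z < 1\<close>] by (simp add: sums_iff)
  ultimately show False
    using nz by force
qed

text \<open>
  Values of \<open>f\<close> can be eliminated: \<open>f b - f a = (f b - f 0) - (f a - f 0)\<close>.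
\<close>

lemma DQ_equals_imp_cocycle:
  assumes "DQ_equals f H" and "0 \<le> a" "a \<le> b" "b \<le> 1"
  shows "(b - a) * H (a, b) = b * H (0, b) - a * H (0, a)"
proof -
  have diff: "f v - f u = (v - u) * H (u, v)" if "0 \<le> u" "u \<le> v" "v \<le> 1" for u v
  proof (cases "u = v")
    case False
    then have "(f v - f u) / (v - u) = H (u, v)"
      using assms(1) that by (force simp: DQ_equals_def DQ_def T_bar_def)
    then show ?thesis
      using False by (simp add: field_simps)
  qed simp
  show ?thesis
    using diff[of a b] diff[of 0 b] diff[of 0 a] assms by simp
qed

lemma DQ_coeffs_const_on_diagonals:
  assumes DQ: "DQ_equals f H"
    and H: "\<And>a b. (a, b) \<in> T_bar \<Longrightarrow>
      (\<lambda>p. \<Sum>i\<le>p. c i (p - i) * a ^ i * b ^ (p - i)) sums H (a, b)"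
    and "i \<le> p"
  shows "c i (p - i) = c 0 p"
proof -
  define e where "e i = c i (p - i) - c 0 p" for i
  have root: "(\<Sum>i\<le>p. e i * s ^ i) = 0" if s: "0 < s" "s < 1" for s
  proof -
    define g where
      "g q = (1 - s) * (\<Sum>i\<le>q. c i (q - i) * s ^ i) - c 0 q + s * (c 0 q * s ^ q)" for q
    have H0: "(\<lambda>q. c 0 q * b ^ q) sums H (0, b)" if b: "0 \<le> b" "b \<le> 1" for b
    proof -
      have "(\<Sum>i\<le>q. c i (q - i) * 0 ^ i * b ^ (q - i)) = c 0 q * b ^ q" for q
        by (subst sum.remove[of _ 0]) (auto intro!: sum.neutral)
      then show ?thesis
        using H[of 0 b] b by (simp add: T_bar_def)
    qed
    have "(\<lambda>q. g q * b ^ q) sums 0" if b: "0 < b" "b < 1" for b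
    proof -
      have sb: "0 \<le> s * b" "s * b \<le> b" "s * b \<le> 1"
        using s b by (auto simp: mult_le_one)
      have "(\<Sum>i\<le>q. c i (q - i) * (s * b) ^ i * b ^ (q - i))
          = (\<Sum>i\<le>q. c i (q - i) * s ^ i) * b ^ q" for q
        unfolding sum_distrib_right
        by (intro sum.cong refl)
           (auto simp: power_mult_distrib mult_ac simp flip: power_add)
      then have ray: "(\<lambda>q. (\<Sum>i\<le>q. c i (q - i) * s ^ i) * b ^ q) sums H (s * b, b)"
        using H[of "s * b" b] sb b by (simp add: T_bar_def)
      have "(\<lambda>q. (1 - s) * ((\<Sum>i\<le>q. c i (q - i) * s ^ i) * b ^ q) - c 0 q * b ^ q
              + s * (c 0 q * (s * b) ^ q))
            sums ((1 - s) * H (s * b, b) - H (0, b) + s * H (0, s * b))"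
        using sb b by (intro sums_add sums_diff sums_mult ray H0) auto
      moreover have "b * ((1 - s) * H (s * b, b) - H (0, b) + s * H (0, s * b)) = 0"
        using DQ_equals_imp_cocycle[OF DQ, of "s * b" b] sb b by (simp add: algebra_simps)
      then have "(1 - s) * H (s * b, b) - H (0, b) + s * H (0, s * b) = 0"
        using b by simp
      ultimately show ?thesis
        by (simp add: g_def algebra_simps power_mult_distrib)
    qed
    then have "g p = 0"
      by (rule powser_zero_coeffs)
    moreover have "g p = (1 - s) * (\<Sum>i\<le>p. e i * s ^ i)"
    proof -
      have "(\<Sum>i\<le>p. e i * s ^ i) = (\<Sum>i\<le>p. c i (p - i) * s ^ i) - c 0 p * (\<Sum>i\<le>p. s ^ i)"
        by (simp add: e_def algebra_simps sum_subtractf sum_distrib_left)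
      then have "(1 - s) * (\<Sum>i\<le>p. e i * s ^ i)
          = (1 - s) * (\<Sum>i\<le>p. c i (p - i) * s ^ i) - c 0 p * ((1 - s) * (\<Sum>i\<le>p. s ^ i))"
        by (simp add: right_diff_distrib)
      then show ?thesis
        unfolding sum_gp_basic by (simp add: g_def right_diff_distrib)
    qed
    ultimately show ?thesis
      using s by simp
  qed
  have "{0<..<1} \<subseteq> {s. (\<Sum>i\<le>p. e i * s ^ i) = 0}"
    using root by auto
  then have "infinite {s. (\<Sum>i\<le>p. e i * s ^ i) = 0}"
    by (metis finite_subset infinite_Ioo zero_less_one)
  then have "e i = 0"
    using polyfun_finite_roots[of e p] \<open>i \<le> p\<close> by auto
  then show ?thesis
    by (simp add: e_def)
qed

section \<open>The primitive of a series that is constant on diagonals\<close>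

text \<open>
  The series \<open>K\<close> converges uniformly on the whole square, not only on the triangle, and there it
  is the difference quotient of \<open>f\<close> in either order of the arguments. Continuity of \<open>K a\<close> at \<open>a\<close>
  therefore gives the two-sided derivative in the interior and the one-sided derivatives at the
  endpoints in one step, whereas the theorem on termwise differentiation inside the disc of
  convergence does not apply at the endpoint 1, which may lie on the boundary of that disc.
\<close>

lemma primitive_has_derivative:
  fixes d :: "nat \<Rightarrow> real"
  assumes d: "summable (\<lambda>p. real (Suc p) * \<bar>d p\<bar>)"
  defines "f \<equiv> \<lambda>x. \<Sum>p. d p * x ^ Suc p"
    and "K \<equiv> \<lambda>a b. \<Sum>p. d p * (\<Sum>i\<le>p. a ^ i * b ^ (p - i))"
  shows primitive_diff: "\<And>a b. a \<in> {0..1} \<Longrightarrow> b \<in> {0..1} \<Longrightarrow> f b - f a = (b - a) * K a b"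
    and primitive_deriv: "\<And>a. a \<in> {0..1} \<Longrightarrow> (f has_field_derivative K a a) (at a within {0..1})"
proof -
  have bound: "norm (d p * (\<Sum>i\<le>p. a ^ i * b ^ (p - i))) \<le> real (Suc p) * \<bar>d p\<bar>"
    if "a \<in> {0..1}" "b \<in> {0..1}" for a b p
  proof -
    have "\<bar>\<Sum>i\<le>p. a ^ i * b ^ (p - i)\<bar> \<le> (\<Sum>i\<le>p. 1)"
      using that by (intro order.trans[OF sum_abs] sum_mono)
        (auto simp: abs_mult power_abs intro!: mult_le_one power_le_one)
    then show ?thesis
      by (simp add: abs_mult mult.commute[of _ "\<bar>d p\<bar>"] mult_left_mono)
  qed
  have summable_f: "summable (\<lambda>p. d p * x ^ Suc p)" if "x \<in> {0..1}" for x
  proof (rule summable_comparison_test'[OF d, where N = 0])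
    fix p
    have "\<bar>d p\<bar> * \<bar>x ^ Suc p\<bar> \<le> \<bar>d p\<bar> * real (Suc p)"
      using that power_le_one[of x "Suc p"] by (intro mult_left_mono) auto
    then show "norm (d p * x ^ Suc p) \<le> real (Suc p) * \<bar>d p\<bar>"
      by (simp only: real_norm_def abs_mult mult.commute)
  qed
  show diff: "f b - f a = (b - a) * K a b" if ab: "a \<in> {0..1}" "b \<in> {0..1}" for a b
  proof -
    have K: "summable (\<lambda>p. d p * (\<Sum>i\<le>p. a ^ i * b ^ (p - i)))"
      using bound[OF ab] by (intro summable_comparison_test'[OF d, where N = 0]) auto
    have "f b - f a = (\<Sum>p. d p * b ^ Suc p - d p * a ^ Suc p)"
      unfolding f_def using ab by (intro suminf_diff summable_f)
    also have "(\<lambda>p. d p * b ^ Suc p - d p * a ^ Suc p)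
        = (\<lambda>p. (b - a) * (d p * (\<Sum>i\<le>p. a ^ i * b ^ (p - i))))"
    proof
      fix p
      have "a ^ Suc p - b ^ Suc p = (a - b) * (\<Sum>i\<le>p. a ^ i * b ^ (p - i))"
        by (metis diff_power_eq_sum lessThan_Suc_atMost)
      then have "b ^ Suc p - a ^ Suc p = (b - a) * (\<Sum>i\<le>p. a ^ i * b ^ (p - i))"
        by (metis minus_diff_eq mult_minus_left)
      then show "d p * b ^ Suc p - d p * a ^ Suc p
          = (b - a) * (d p * (\<Sum>i\<le>p. a ^ i * b ^ (p - i)))"
        by (simp only: mult.left_commute flip: right_diff_distrib)
    qed
    also have "(\<Sum>p. (b - a) * (d p * (\<Sum>i\<le>p. a ^ i * b ^ (p - i)))) = (b - a) * K a b"
      unfolding K_def by (rule suminf_mult[OF K])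
    finally show ?thesis .
  qed
  show "(f has_field_derivative K a a) (at a within {0..1})" if a: "a \<in> {0..1}" for a
    unfolding has_field_derivative_iff
  proof (rule Lim_transform_eventually)
    have "continuous_on {0..1} (K a)"
      unfolding K_def
      by (rule uniform_limit_theorem[OF _ Weierstrass_m_test[OF bound[OF a] d]])
         (auto intro!: always_eventually continuous_intros)
    then show "(K a \<longlongrightarrow> K a a) (at a within {0..1})"
      using a by (auto simp: continuous_on_def)
    show "\<forall>\<^sub>F y in at a within {0..1}. K a y = (f y - f a) / (y - a)"
      using diff[OF a] by (auto simp: eventually_at_filter)
  qed
qed

lemma primitive_DQ_equals:
  fixes d :: "nat \<Rightarrow> real"
  assumes d: "summable (\<lambda>p. real (Suc p) * \<bar>d p\<bar>)"
    and H: "\<And>a b. (a, b) \<in> T_bar \<Longrightarrow>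
      (\<lambda>p. d p * (\<Sum>i\<le>p. a ^ i * b ^ (p - i))) sums H (a, b)"
  shows "DQ_equals (\<lambda>x. \<Sum>p. d p * x ^ Suc p) H"
proof -
  define f where "f = (\<lambda>x. \<Sum>p. d p * x ^ Suc p)"
  have K: "(\<Sum>p. d p * (\<Sum>i\<le>p. a ^ i * b ^ (p - i))) = H (a, b)" if "(a, b) \<in> T_bar" for a b
    using H[OF that] by (simp add: sums_iff)
  have deriv: "(f has_field_derivative H (a, a)) (at a within {0..1})" if "a \<in> {0..1}" for a
    using primitive_deriv[OF d that] K[of a a] that by (simp add: f_def T_bar_def)
  have "DQ f (a, b) = H (a, b)" if ab: "(a, b) \<in> T_bar" for a b
  proof (cases "a = b")
    case True
    with ab have "a \<in> {0..1}"
      by (auto simp: T_bar_def)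
    with deriv[OF this] show ?thesis
      using True vector_derivative_within_closed_interval[of 0 1 a f]
      by (simp add: DQ_def has_real_derivative_iff_has_vector_derivative)
  next
    case False
    have "f b - f a = (b - a) * H (a, b)"
      using primitive_diff[OF d, of a b] K[OF ab] ab by (simp add: f_def T_bar_def)
    with False show ?thesis
      by (simp add: DQ_def)
  qed
  moreover have "f differentiable_on {0..1}"
    unfolding differentiable_on_def
    using deriv by (meson real_differentiable_def field_differentiable_def field_differentiable_imp_differentiable)
  ultimately show ?thesis
    by (auto simp: DQ_equals_def f_def)
qed

section \<open>The equivalence\<close>

theorem theorem7:
  fixes H :: "real \<times> real \<Rightarrow> real" and c :: "nat \<Rightarrow> nat \<Rightarrow> real"
  assumes abs_conv: "\<And>a b. (a, b) \<in> T_bar \<Longrightarrow>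
      (\<lambda>(i, j). \<bar>c i j * a ^ i * b ^ j\<bar>) summable_on UNIV"
    and H_series: "\<And>a b. (a, b) \<in> T_bar \<Longrightarrow>
      H (a, b) = (\<Sum>\<^sub>\<infinity>(i, j)\<in>UNIV. c i j * a ^ i * b ^ j)"
  shows "(\<exists>f :: real \<Rightarrow> real. DQ_equals f H) \<longleftrightarrow>
         (\<forall>p :: nat. \<exists>cp :: real. \<forall>i j. i + j = p \<longrightarrow> c i j = cp)"
proof -
  have diagonals: "(\<lambda>p. \<Sum>i\<le>p. c i (p - i) * a ^ i * b ^ (p - i)) sums H (a, b)"
    if ab: "(a, b) \<in> T_bar" for a b
  proof -
    have "(\<lambda>(i, j). c i j * a ^ i * b ^ j) summable_on UNIV"
      using abs_conv[OF ab] by (simp add: abs_summable_summable case_prod_unfold)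
    then have "((\<lambda>(i, j). c i j * a ^ i * b ^ j) has_sum H (a, b)) UNIV"
      by (simp add: H_series[OF ab] has_sum_infsum)
    from has_sum_imp_diagonals_sums[OF this] show ?thesis
      by simp
  qed
  show ?thesis
  proof
    assume "\<exists>f. DQ_equals f H"
    then obtain f where "DQ_equals f H" ..
    then have "c i (p - i) = c 0 p" if "i \<le> p" for i p
      using DQ_coeffs_const_on_diagonals diagonals that by blast
    then have "c i j = c 0 (i + j)" for i j
      by (metis diff_add_inverse le_add1)
    then show "\<forall>p. \<exists>cp. \<forall>i j. i + j = p \<longrightarrow> c i j = cp"
      by metis
  next
    assume "\<forall>p. \<exists>cp. \<forall>i j. i + j = p \<longrightarrow> c i j = cp"
    then obtain d where d: "\<And>i j. c i j = d (i + j)"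
      by metis
    \<comment> \<open>At the corner \<open>(1, 1)\<close> each of the \<open>p + 1\<close> entries of the diagonal contributes \<open>\<bar>d p\<bar>\<close>.\<close>
    have "summable (\<lambda>p. \<Sum>i\<le>p. \<bar>c i (p - i)\<bar>)"
      using has_sum_imp_diagonals_sums[OF has_sum_infsum[OF abs_conv[of 1 1]]]
      by (simp add: T_bar_def sums_iff)
    then have "summable (\<lambda>p. real (Suc p) * \<bar>d p\<bar>)"
      by (simp add: d)
    moreover have "(\<lambda>p. d p * (\<Sum>i\<le>p. a ^ i * b ^ (p - i))) sums H (a, b)"
      if "(a, b) \<in> T_bar" for a b
      using diagonals[OF that] by (simp add: d sum_distrib_left mult.assoc)
    ultimately show "\<exists>f. DQ_equals f H"
      using primitive_DQ_equals by blast
  qed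
qed

end
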